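(* Let $G=(V,E)$ be an infinite, connected, locally finite graph with bounded degree, let $a:E\to\mathbb{R}_+^\star$ and $W:V\to\mathbb{R}$, and let $H=\Delta_{1,a}+W$ be the corresponding Schrödinger operator on $G$. Assume that $V$ with the metric associated to the distance $\delta_a$ is complete, and that there exists a real number $k$ such that $$\langle Hg,g\rangle_{l^2}\ge k\|g\|_{l^2}^2\qquad\text{for every } g\in C_0(V).$$ Then the operator $H$, with domain $C_0(V)$, is essentially self-adjoint (as an operator on $l^2(V)$).
   Context: $G=(V,E)$ is a graph with vertex set $V$ and edge set $E$, whose edges are unordered pairs $\{x,y\}$ of distinct vertices; $x\sim y$ means $\{x,y\}\in E$. The graph has bounded degree if there is an integer $N$ with $\sharp\{y\in V: y\sim x\}\le N$ for every $x\in V$. $\mathbb{R}_+^\star=(0,\infty)$. A function $a$ on $E$ is written $a_{x,y}=a_{y,x}$ for $\{x,y\}\in E$. $C_0(V)$ is the space of finitely supported functions $V\to\mathbb{R}$. $l^2(V)=\{f:V\to\mathbb{R}:\sum_{x\in V}|f(x)|^2<\infty\}$ is a Hilbert space with scalar product $\langle f,g\rangle_{l^2}=\sum_{x\in V}f(x)g(x)$. The Schrödinger operator $\Delta_{1,a}+W$ acts by $$((\Delta_{1,a}+W)f)(x)=\sum_{y\sim x}a_{x,y}(f(x)-f(y))+W(x)f(x).$$ The $a$-weighted distance is $\delta_a(x,y)=\inf_{\gamma}L(\gamma)$, the infimum being over all finite edge paths $\gamma: x_1=x,x_2,\dots,x_n=y$ (with $x_i\sim x_{i+1}$) linking $x$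 to $y$, where $L(\gamma)=\sum_{1\le i\le n-1}\frac{1}{\sqrt{a_{x_i,x_{i+1}}}}$. An unbounded symmetric linear operator on a Hilbert space is essentially self-adjoint if it has a unique self-adjoint extension. *)

theory Defs
  imports "HOL-Analysis.Analysis"
begin

section \<open>Graphs\<close>

text \<open>
  The vertex set is the whole type \<open>'v\<close>; the edge set consists of unordered pairs.
  Edge weights are functions on sets of vertices, so \<open>a {x, y} = a {y, x}\<close> holds by
  construction; the values of \<open>a\<close> outside of \<open>E\<close> are never used.
\<close>

definition simple_graph :: "'v set set \<Rightarrow> bool" where
  "simple_graph E \<longleftrightarrow> (\<forall>e\<in>E. \<exists>x y. x \<noteq> y \<and> e = {x, y})"

definition neighbours :: "'v set set \<Rightarrow> 'v \<Rightarrow> 'v set" where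
  "neighbours E x = {y. {x, y} \<in> E}"

definition locally_finite_graph :: "'v set set \<Rightarrow> bool" where
  "locally_finite_graph E \<longleftrightarrow> (\<forall>x. finite (neighbours E x))"

text \<open>Finiteness is required explicitly since \<^const>\<open>card\<close> is 0 on infinite sets.\<close>

definition bounded_degree :: "'v set set \<Rightarrow> bool" where
  "bounded_degree E \<longleftrightarrow> (\<exists>N. \<forall>x. finite (neighbours E x) \<and> card (neighbours E x) \<le> N)"

definition edge_path :: "'v set set \<Rightarrow> 'v \<Rightarrow> 'v list \<Rightarrow> 'v \<Rightarrow> bool" where
  "edge_path E x p y \<longleftrightarrow>
     p \<noteq> [] \<and> hd p = x \<and> last p = y \<and> successively (\<lambda>u v. {u, v} \<in> E) p"

definition connected_graph :: "'v set set \<Rightarrow> bool" where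
  "connected_graph E \<longleftrightarrow> (\<forall>x y. \<exists>p. edge_path E x p y)"

fun weighted_length :: "('v set \<Rightarrow> real) \<Rightarrow> 'v list \<Rightarrow> real" where
  "weighted_length a (x # y # p) = 1 / sqrt (a {x, y}) + weighted_length a (y # p)"
| "weighted_length a _ = 0"

text \<open>The constant path \<open>[x]\<close> is admitted, so the distance from \<open>x\<close> to itself is 0.\<close>

definition weighted_dist :: "'v set set \<Rightarrow> ('v set \<Rightarrow> real) \<Rightarrow> 'v \<Rightarrow> 'v \<Rightarrow> real" where
  "weighted_dist E a x y = Inf {weighted_length a p |p. edge_path E x p y}"

lemma weighted_length_nonneg:
  assumes "\<forall>e\<in>E. a e > 0" "successively (\<lambda>u v. {u, v} \<in> E) p"
  shows "weighted_length a p \<ge> 0"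
  using assms
proof (induction a p rule: weighted_length.induct)
  case (1 a x y p)
  then have "weighted_length a (y # p) \<ge> 0" by simp
  moreover have "a {x, y} > 0" using 1 by simp
  ultimately show ?case by simp
qed auto

lemma weighted_length_append:
  "weighted_length a (p @ x # q) = weighted_length a (p @ [x]) + weighted_length a (x # q)"
proof (induction p)
  case (Cons y p)
  then show ?case by (cases p) auto
qed simp

lemma weighted_length_rev: "weighted_length a (rev p) = weighted_length a p"
proof (induction a p rule: weighted_length.induct)
  case (1 a x y p)
  then show ?case
    using weighted_length_append[of a "rev p" y "[x]"] by (simp add: insert_commute)
qed auto

lemma weighted_dist_Metric_space:
  assumes "locally_finite_graph E" "connected_graph E" and pos: "\<forall>e\<in>E. a e > 0"
  shows "Metric_space UNIV (weighted_dist E a)"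
proof -
  let ?S = "\<lambda>x y. {weighted_length a p |p. edge_path E x p y}"
  have ne: "?S x y \<noteq> {}" for x y
    using assms(2) by (auto simp: connected_graph_def)
  have ge0: "0 \<le> s" if "s \<in> ?S x y" for s x y
    using that weighted_length_nonneg[OF pos] by (auto simp: edge_path_def)
  have bdd: "bdd_below (?S x y)" for x y
    using ge0 by (meson bdd_belowI)
  show ?thesis
  proof
    show "0 \<le> weighted_dist E a x y" for x y
      unfolding weighted_dist_def by (rule cInf_greatest[OF ne ge0])
  next
    have sub: "?S x y \<subseteq> ?S y x" for x y
    proof
      fix s assume "s \<in> ?S x y"
      then obtain p where p: "s = weighted_length a p" "edge_path E x p y" by auto
      then have "edge_path E y (rev p) x"
        by (auto simp: edge_path_def hd_rev last_rev insert_commute)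
      then show "s \<in> ?S y x"
        using p(1) weighted_length_rev[of a p] unfolding mem_Collect_eq by metis
    qed
    show "weighted_dist E a x y = weighted_dist E a y x" for x y
      unfolding weighted_dist_def by (rule arg_cong[where f = Inf]) (intro equalityI sub)
  next
    fix x y
    show "weighted_dist E a x y = 0 \<longleftrightarrow> x = y"
    proof
      assume "x = y"
      have "edge_path E x [x] x" by (simp add: edge_path_def)
      then have "0 \<in> ?S x y" using \<open>x = y\<close> by force
      then have "weighted_dist E a x y \<le> 0"
        unfolding weighted_dist_def by (rule cInf_lower[OF _ bdd])
      moreover have "weighted_dist E a x y \<ge> 0"
        unfolding weighted_dist_def by (rule cInf_greatest[OF ne ge0])
      ultimately show "weighted_dist E a x y = 0" by simp
    next
      assume d0: "weighted_dist E a x y = 0"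
      show "x = y"
      proof (rule ccontr)
        assume "x \<noteq> y"
        define L where "L = (\<lambda>z. 1 / sqrt (a {x, z})) ` neighbours E x"
        have fin: "finite L"
          using assms(1) by (simp add: L_def locally_finite_graph_def)
        have low: "\<exists>l\<in>L. l \<le> s" if "s \<in> ?S x y" for s
        proof -
          from that obtain p where p: "s = weighted_length a p" "edge_path E x p y" by auto
          then obtain z q where q: "p = x # z # q"
            using \<open>x \<noteq> y\<close> unfolding edge_path_def
            by (cases p rule: weighted_length.cases[of "(a, p)" for p, simplified]) auto
          have "z \<in> neighbours E x" "weighted_length a (z # q) \<ge> 0"
            using p(2) q weighted_length_nonneg[OF pos, of "z # q"]
            by (auto simp: edge_path_def neighbours_def)
          then show ?thesis using p(1) q
            by (intro bexI[of _ "1 / sqrt (a {x, z})"]) (auto simp: L_def)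
        qed
        have "L \<noteq> {}" using ne[of x y] low by blast
        have "l > 0" if "l \<in> L" for l
          using that pos by (auto simp: L_def neighbours_def)
        then have "Min L > 0" using fin \<open>L \<noteq> {}\<close> by simp
        moreover have "Min L \<le> weighted_dist E a x y"
          unfolding weighted_dist_def
        proof (rule cInf_greatest[OF ne])
          fix s assume "s \<in> ?S x y"
          from low[OF this] show "Min L \<le> s" using fin by (meson Min_le order_trans)
        qed
        ultimately show False using d0 by simp
      qed
    qed
  next
    fix x y z
    have key: "weighted_dist E a x z \<le> s + t" if st: "s \<in> ?S x y" "t \<in> ?S y z" for s t
    proof -
      obtain p q where p: "s = weighted_length a p" "edge_path E x p y"
        and q: "t = weighted_length a q" "edge_path E y q z" using st by auto
      define p' q' where "p' = butlast p" and "q' = tl q"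
      have p': "p = p' @ [y]" and q': "q = y # q'"
        using p(2) q(2) append_butlast_last_id[of p] by (auto simp: edge_path_def p'_def q'_def)
      have "edge_path E x (p' @ y # q') z"
        using p(2) q(2) unfolding p' q'
        by (cases p') (auto simp: edge_path_def successively_append_iff successively_Cons hd_append)
      moreover have "weighted_length a (p' @ y # q') = s + t"
        using p(1) q(1) p' q' weighted_length_append by metis
      ultimately have "s + t \<in> ?S x z" by force
      then show ?thesis unfolding weighted_dist_def by (rule cInf_lower[OF _ bdd])
    qed
    have "weighted_dist E a x z - s \<le> weighted_dist E a y z" if "s \<in> ?S x y" for s
      unfolding weighted_dist_def[of E a y z]
      using key[OF that] by (intro cInf_greatest[OF ne]) (simp add: algebra_simps)
    then have "weighted_dist E a x z - weighted_dist E a y z \<le> s" if "s \<in> ?S x y" for s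
      using that by (simp add: algebra_simps)
    then have "weighted_dist E a x z - weighted_dist E a y z \<le> weighted_dist E a x y"
      unfolding weighted_dist_def[of E a x y] by (rule cInf_greatest[OF ne])
    then show "weighted_dist E a x z \<le> weighted_dist E a x y + weighted_dist E a y z" by simp
  qed
qed


section \<open>The Hilbert space of square-summable real functions\<close>

typedef 'v l2 = "{f :: 'v \<Rightarrow> real. (\<lambda>x. (f x)\<^sup>2) summable_on UNIV}"
  morphisms l2_fun Abs_l2
  by (rule exI[of _ "\<lambda>_. 0"]) simp

setup_lifting type_definition_l2

lemma l2_summable: "(\<lambda>x. (l2_fun f x)\<^sup>2) summable_on UNIV"
  using l2_fun[of f] by simp

lemma l2_mult_summable:
  fixes f g :: "'v \<Rightarrow> real"
  assumes "(\<lambda>x. (f x)\<^sup>2) summable_on UNIV" "(\<lambda>x. (g x)\<^sup>2) summable_on UNIV"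
  shows "(\<lambda>x. f x * g x) summable_on UNIV"
proof -
  have "(\<lambda>x. norm (f x * f x)) summable_on UNIV" "(\<lambda>x. norm (g x * g x)) summable_on UNIV"
    using assms by (simp_all add: power2_eq_square)
  from abs_summable_product[OF this] show ?thesis
    using summable_on_iff_abs_summable_on_real by blast
qed

instantiation l2 :: (type) real_vector
begin

lift_definition zero_l2 :: "'a l2" is "\<lambda>_. 0" by simp

lift_definition plus_l2 :: "'a l2 \<Rightarrow> 'a l2 \<Rightarrow> 'a l2" is "\<lambda>f g x. f x + g x"
proof -
  fix f g :: "'a \<Rightarrow> real"
  assume f: "(\<lambda>x. (f x)\<^sup>2) summable_on UNIV" and g: "(\<lambda>x. (g x)\<^sup>2) summable_on UNIV"
  show "(\<lambda>x. (f x + g x)\<^sup>2) summable_on UNIV"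
    unfolding power2_sum mult.assoc
    by (intro summable_on_add f g summable_on_cmult_right l2_mult_summable)
qed

lift_definition uminus_l2 :: "'a l2 \<Rightarrow> 'a l2" is "\<lambda>f x. - f x" by simp

lift_definition scaleR_l2 :: "real \<Rightarrow> 'a l2 \<Rightarrow> 'a l2" is "\<lambda>c f x. c * f x"
  by (simp add: power_mult_distrib summable_on_cmult_right)

definition minus_l2 :: "'a l2 \<Rightarrow> 'a l2 \<Rightarrow> 'a l2" where
  "minus_l2 f g = f + - g"

instance
  by (standard; (rule minus_l2_def | (transfer, simp add: algebra_simps)))

end

instantiation l2 :: (type) real_inner
begin

lift_definition inner_l2 :: "'a l2 \<Rightarrow> 'a l2 \<Rightarrow> real" is "\<lambda>f g. \<Sum>\<^sub>\<infinity>x. f x * g x" .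

definition norm_l2 :: "'a l2 \<Rightarrow> real" where "norm_l2 f = sqrt (inner f f)"
definition sgn_l2 :: "'a l2 \<Rightarrow> 'a l2" where "sgn_l2 f = f /\<^sub>R norm f"
definition dist_l2 :: "'a l2 \<Rightarrow> 'a l2 \<Rightarrow> real" where "dist_l2 f g = norm (f - g)"
definition uniformity_l2 :: "('a l2 \<times> 'a l2) filter" where
  "uniformity_l2 = (INF e\<in>{0<..}. principal {(f, g). dist f g < e})"
definition open_l2 :: "'a l2 set \<Rightarrow> bool" where
  "open_l2 U = (\<forall>f\<in>U. \<forall>\<^sub>F (f', g) in uniformity. f' = f \<longrightarrow> g \<in> U)"

instance
proof
  fix f g h :: "'a l2" and c :: real
  show "inner f g = inner g f" by transfer (simp add: mult.commute)
  show "inner (f + g) h = inner f h + inner g h"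
    by transfer (simp add: distrib_right infsum_add l2_mult_summable)
  show "inner (c *\<^sub>R f) g = c * inner f g"
    by transfer (simp add: mult.assoc infsum_cmult_right')
  show "0 \<le> inner f f" by transfer (simp add: infsum_nonneg)
  show "inner f f = 0 \<longleftrightarrow> f = 0"
  proof transfer
    fix f :: "'a \<Rightarrow> real" assume f: "(\<lambda>x. (f x)\<^sup>2) summable_on UNIV"
    show "((\<Sum>\<^sub>\<infinity>x. f x * f x) = 0) = (f = (\<lambda>_. 0))"
    proof
      assume "(\<Sum>\<^sub>\<infinity>x. f x * f x) = 0"
      then have "f x * f x = 0" for x
        using nonneg_infsum_le_0D[of "\<lambda>x. f x * f x" UNIV x] f by (simp add: power2_eq_square)
      then show "f = (\<lambda>_. 0)" by auto
    qed simp
  qed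
qed (simp_all add: norm_l2_def sgn_l2_def dist_l2_def uniformity_l2_def open_l2_def)

end

lemma l2_fun_diff: "l2_fun (f - g) x = l2_fun f x - l2_fun g x"
  unfolding minus_l2_def by transfer simp

lemma norm_l2_power2: "(norm f)\<^sup>2 = (\<Sum>\<^sub>\<infinity>x. (l2_fun f x)\<^sup>2)"
  unfolding power2_norm_eq_inner inner_l2.rep_eq by (simp add: power2_eq_square)

lemma sum_le_norm_l2:
  assumes "finite F"
  shows "(\<Sum>x\<in>F. (l2_fun f x)\<^sup>2) \<le> (norm f)\<^sup>2"
  unfolding norm_l2_power2 using assms by (intro finite_sum_le_infsum l2_summable) auto

instance l2 :: (type) complete_space
proof
  fix X :: "nat \<Rightarrow> 'a l2"
  assume "Cauchy X"
  have "Cauchy (\<lambda>n. l2_fun (X n) x)" for x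
  proof (rule metric_CauchyI)
    fix e :: real assume "e > 0"
    then obtain M where M: "\<And>m n. m \<ge> M \<Longrightarrow> n \<ge> M \<Longrightarrow> dist (X m) (X n) < e"
      using \<open>Cauchy X\<close> by (meson metric_CauchyD)
    have "dist (l2_fun (X m) x) (l2_fun (X n) x) < e" if "m \<ge> M" "n \<ge> M" for m n
    proof -
      have "(l2_fun (X m - X n) x)\<^sup>2 \<le> (norm (X m - X n))\<^sup>2"
        using sum_le_norm_l2[of "{x}"] by simp
      then have "\<bar>l2_fun (X m - X n) x\<bar> \<le> norm (X m - X n)"
        using abs_le_square_iff[of "l2_fun (X m - X n) x" "norm (X m - X n)"] by simp
      then show ?thesis
        using M[OF that] by (simp add: l2_fun_diff dist_real_def dist_norm)
    qed
    then show "\<exists>M. \<forall>m\<ge>M. \<forall>n\<ge>M. dist (l2_fun (X m) x) (l2_fun (X n) x) < e" by blast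
  qed
  then have "\<exists>l. (\<lambda>n. l2_fun (X n) x) \<longlonglongrightarrow> l" for x
    using Cauchy_convergent convergent_def by blast
  then obtain f where f: "\<And>x. (\<lambda>n. l2_fun (X n) x) \<longlonglongrightarrow> f x" by metis
  have bound: "\<exists>M. \<forall>n\<ge>M. \<forall>F. finite F \<longrightarrow> (\<Sum>x\<in>F. (l2_fun (X n) x - f x)\<^sup>2) \<le> e\<^sup>2"
    if "e > 0" for e
  proof -
    obtain M where M: "\<And>m n. m \<ge> M \<Longrightarrow> n \<ge> M \<Longrightarrow> dist (X m) (X n) < e"
      using \<open>Cauchy X\<close> \<open>e > 0\<close> by (meson metric_CauchyD)
    have "(\<Sum>x\<in>F. (l2_fun (X n) x - f x)\<^sup>2) \<le> e\<^sup>2" if "n \<ge> M" "finite F" for n F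
    proof (rule tendsto_upperbound)
      show "(\<lambda>m. \<Sum>x\<in>F. (l2_fun (X n) x - l2_fun (X m) x)\<^sup>2)
              \<longlonglongrightarrow> (\<Sum>x\<in>F. (l2_fun (X n) x - f x)\<^sup>2)"
        by (intro tendsto_intros f)
      show "\<forall>\<^sub>F m in sequentially. (\<Sum>x\<in>F. (l2_fun (X n) x - l2_fun (X m) x)\<^sup>2) \<le> e\<^sup>2"
      proof (rule eventually_sequentiallyI[of M])
        fix m assume "m \<ge> M"
        have "(\<Sum>x\<in>F. (l2_fun (X n) x - l2_fun (X m) x)\<^sup>2) \<le> (norm (X n - X m))\<^sup>2"
          using sum_le_norm_l2[OF \<open>finite F\<close>, of "X n - X m"] by (simp add: l2_fun_diff)
        also have "\<dots> \<le> e\<^sup>2"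
          using M[OF \<open>n \<ge> M\<close> \<open>m \<ge> M\<close>] by (intro power_mono) (auto simp: dist_norm)
        finally show "(\<Sum>x\<in>F. (l2_fun (X n) x - l2_fun (X m) x)\<^sup>2) \<le> e\<^sup>2" .
      qed
    qed simp
    then show ?thesis by blast
  qed
  obtain N where N: "\<And>F. finite F \<Longrightarrow> (\<Sum>x\<in>F. (l2_fun (X N) x - f x)\<^sup>2) \<le> 1"
    using bound[of 1] by auto
  have "(\<lambda>x. (l2_fun (X N) x - f x)\<^sup>2) summable_on UNIV"
    using N by (intro nonneg_bdd_above_summable_on bdd_aboveI2[of _ _ 1]) auto
  then have d: "l2_fun (Abs_l2 (\<lambda>x. l2_fun (X N) x - f x)) = (\<lambda>x. l2_fun (X N) x - f x)"
    by (simp add: Abs_l2_inverse)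
  define Y where "Y = X N - Abs_l2 (\<lambda>x. l2_fun (X N) x - f x)"
  have Y: "l2_fun Y x = f x" for x
    by (simp add: Y_def l2_fun_diff d)
  have "X \<longlonglongrightarrow> Y"
  proof (rule metric_LIMSEQ_I)
    fix e :: real assume "e > 0"
    then obtain M where M: "\<And>n F. n \<ge> M \<Longrightarrow> finite F \<Longrightarrow>
        (\<Sum>x\<in>F. (l2_fun (X n) x - f x)\<^sup>2) \<le> (e / 2)\<^sup>2"
      using bound[of "e / 2"] by auto
    have "dist (X n) Y < e" if "n \<ge> M" for n
    proof -
      have "(norm (X n - Y))\<^sup>2 \<le> (e / 2)\<^sup>2"
        unfolding norm_l2_power2
        using M[OF that] by (intro infsum_le_finite_sums l2_summable) (simp add: l2_fun_diff Y)
      then have "norm (X n - Y) \<le> e / 2"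
        by (rule power2_le_imp_le) (use \<open>e > 0\<close> in simp)
      then show ?thesis using \<open>e > 0\<close> by (simp add: dist_norm)
    qed
    then show "\<exists>M. \<forall>n\<ge>M. dist (X n) Y < e" by blast
  qed
  then show "convergent X" by (auto simp: convergent_def)
qed


section \<open>Unbounded operators\<close>

text \<open>
  A partially defined operator on a real Hilbert space is represented by its graph, so its
  domain is \<^term>\<open>Domain T\<close>, and \<open>T \<subseteq> S\<close> means that \<open>S\<close> extends \<open>T\<close>.
\<close>

definition linear_operator :: "('h::{real_inner, complete_space} \<times> 'h) set \<Rightarrow> bool" where
  "linear_operator T \<longleftrightarrow> subspace T \<and> single_valued T"

definition densely_defined :: "('h::{real_inner, complete_space} \<times> 'h) set \<Rightarrow> bool" where
  "densely_defined T \<longleftrightarrow> closure (Domain T) = UNIV"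

definition symmetric_operator :: "('h::{real_inner, complete_space} \<times> 'h) set \<Rightarrow> bool" where
  "symmetric_operator T \<longleftrightarrow> linear_operator T \<and> densely_defined T \<and>
     (\<forall>(f, Tf)\<in>T. \<forall>(g, Tg)\<in>T. inner Tf g = inner f Tg)"

text \<open>
  The adjoint: \<open>g\<close> lies in its domain and is mapped to \<open>h\<close> iff \<open>\<langle>T f, g\<rangle> = \<langle>f, h\<rangle>\<close>
  for all \<open>f\<close> in the domain of \<open>T\<close>.
\<close>

definition adjoint_operator ::
    "('h::{real_inner, complete_space} \<times> 'h) set \<Rightarrow> ('h \<times> 'h) set" where
  "adjoint_operator T = {(g, h). \<forall>(f, Tf)\<in>T. inner Tf g = inner f h}"

definition self_adjoint_operator :: "('h::{real_inner, complete_space} \<times> 'h) set \<Rightarrow> bool" where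
  "self_adjoint_operator T \<longleftrightarrow>
     linear_operator T \<and> densely_defined T \<and> adjoint_operator T = T"

definition essentially_self_adjoint :: "('h::{real_inner, complete_space} \<times> 'h) set \<Rightarrow> bool" where
  "essentially_self_adjoint T \<longleftrightarrow>
     symmetric_operator T \<and> (\<exists>!S. self_adjoint_operator S \<and> T \<subseteq> S)"


section \<open>Schroedinger operators\<close>

definition C0 :: "('v \<Rightarrow> real) set" where
  "C0 = {f. finite {x. f x \<noteq> 0}}"

definition schroedinger ::
    "'v set set \<Rightarrow> ('v set \<Rightarrow> real) \<Rightarrow> ('v \<Rightarrow> real) \<Rightarrow> ('v \<Rightarrow> real) \<Rightarrow> 'v \<Rightarrow> real" where
  "schroedinger E a W f x = (\<Sum>y\<in>neighbours E x. a {x, y} * (f x - f y)) + W x * f x"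

text \<open>
  The operator with domain \<open>C0\<close>. On a locally finite graph it maps \<open>C0\<close> into itself, and
  \<open>C0\<close> consists of square-summable functions, so \<open>Abs_l2\<close> is only applied to such
  functions; see \<open>C0_square_summable\<close> and \<open>schroedinger_C0\<close>.
\<close>

definition schroedinger_operator ::
    "'v set set \<Rightarrow> ('v set \<Rightarrow> real) \<Rightarrow> ('v \<Rightarrow> real) \<Rightarrow> ('v l2 \<times> 'v l2) set" where
  "schroedinger_operator E a W = {(Abs_l2 f, Abs_l2 (schroedinger E a W f)) |f. f \<in> C0}"

lemma C0_square_summable:
  assumes "f \<in> C0"
  shows "(\<lambda>x. (f x)\<^sup>2) summable_on UNIV"
proof -
  have "(\<lambda>x. (f x)\<^sup>2) summable_on {x. f x \<noteq> 0}"
    using assms by (simp add: C0_def)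
  then show ?thesis
    by (rule summable_on_cong_neutral[THEN iffD1, rotated -1]) auto
qed

lemma schroedinger_C0:
  assumes "locally_finite_graph E" "f \<in> C0"
  shows "schroedinger E a W f \<in> C0"
proof -
  let ?S = "{x. f x \<noteq> 0}"
  have "schroedinger E a W f x = 0" if "x \<notin> ?S \<union> (\<Union>y\<in>?S. neighbours E y)" for x
  proof -
    have "f y = 0" if "y \<in> neighbours E x" for y
      using that \<open>x \<notin> _\<close> by (auto simp: neighbours_def insert_commute)
    then show ?thesis using that by (simp add: schroedinger_def)
  qed
  then have "{x. schroedinger E a W f x \<noteq> 0} \<subseteq> ?S \<union> (\<Union>y\<in>?S. neighbours E y)" by blast
  moreover have "finite (?S \<union> (\<Union>y\<in>?S. neighbours E y))"
    using assms by (simp add: C0_def locally_finite_graph_def)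
  ultimately show ?thesis unfolding C0_def by (simp add: finite_subset)
qed

end

theory Submission
  imports Defs
begin

text \<open>
  After a shift \<open>H - (k - 1) \<ge> 1\<close>, so the closure of \<open>H - (k - 1)\<close> has closed range, and
  \<open>H\<close> is essentially self-adjoint as soon as every \<open>v\<close> in \<open>l\<^sup>2\<close> with \<open>H v = (k - 1) v\<close> vanishes.
  For such \<open>v\<close> and a finitely supported cutoff \<open>\<phi>\<close> one has
  \<open>\<langle>(H - (k - 1)) (\<phi> v), \<phi> v\<rangle> = 1/2 \<Sum>\<^sub>x \<Sum>\<^sub>y a\<^sub>x\<^sub>y v(x) v(y) (\<phi>(x) - \<phi>(y))\<^sup>2\<close>.
  If \<open>\<phi>\<close> is \<open>\<epsilon>\<close>-Lipschitz for \<open>\<delta>\<^sub>a\<close>, then \<open>a\<^sub>x\<^sub>y (\<phi>(x) - \<phi>(y))\<^sup>2 \<le> \<epsilon>\<^sup>2\<close> on edges and the right-hand side is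
  at most \<open>N \<epsilon>\<^sup>2 \<parallel>v\<parallel>\<^sup>2 / 2\<close>. The choice \<open>\<phi> = max 0 (1 - \<epsilon> \<delta>\<^sub>a(z, \<cdot>))\<close>, which is finitely supported because
  balls of a complete locally finite weighted graph are finite, gives \<open>v(z)\<^sup>2 \<le> N \<epsilon>\<^sup>2 \<parallel>v\<parallel>\<^sup>2 / 2\<close>.
\<close>

section \<open>Symmetric operators bounded from below\<close>

text \<open>The vector is \<open>x - l\<close>, where \<open>x\<close> lies outside \<open>S\<close>
  and \<open>l\<close> is the nearest point of \<open>S\<close>. Completeness provides
  \<open>l\<close> as the limit of a minimising sequence.\<close>

lemma closed_subspace_orthogonal_vector:
  fixes S :: "'h::{real_inner, complete_space} set"
  assumes "subspace S" "closed S" "S \<noteq> UNIV"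
  obtains v where "v \<noteq> 0" "\<And>s. s \<in> S \<Longrightarrow> inner v s = 0"
proof -
  obtain x where x: "x \<notin> S" using assms(3) by blast
  have "0 \<in> S" using assms(1) by (rule subspace_0)
  define d where "d = infdist x S"
  have d0: "d \<ge> 0" by (simp add: d_def infdist_nonneg)
  have dle: "d \<le> norm (x - s)" if "s \<in> S" for s
    using infdist_le[OF that, of x] by (simp add: d_def dist_norm)
  have "\<exists>s\<in>S. norm (x - s) < d + 1 / real (Suc n)" for n
  proof -
    have "infdist x S < d + 1 / real (Suc n)" by (simp add: d_def)
    moreover have "S \<noteq> {}" using \<open>0 \<in> S\<close> by blast
    ultimately have "Inf (dist x ` S) < d + 1 / real (Suc n)" by (simp add: infdist_notempty)
    then show ?thesis
      using \<open>S \<noteq> {}\<close> cInf_lessD[of "dist x ` S"] by (auto simp: dist_norm)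
  qed
  then obtain s where s: "\<And>n. s n \<in> S" "\<And>n. norm (x - s n) < d + 1 / real (Suc n)" by metis
  have "(\<lambda>n. d + 1 / real (Suc n)) \<longlonglongrightarrow> d"
    using tendsto_add[OF tendsto_const[of d] LIMSEQ_Suc[OF lim_1_over_n]] by simp
  then have lim: "(\<lambda>n. norm (x - s n)) \<longlonglongrightarrow> d"
    by (rule tendsto_sandwich[rotated 3, where f = "\<lambda>_. d"])
      (use dle s less_imp_le in \<open>blast intro!: always_eventually\<close>)+
  \<comment> \<open>Parallelogram law: the midpoint \<open>?w\<close> again lies in
    \<open>S\<close>, so its distance to \<open>x\<close> is at least \<open>d\<close>. This makes
    the minimising sequence Cauchy.\<close>
  have par: "(norm (s m - s n))\<^sup>2 \<le> 2 * (norm (x - s m))\<^sup>2 + 2 * (norm (x - s n))\<^sup>2 - 4 * d\<^sup>2" for m n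
  proof -
    let ?w = "(1/2) *\<^sub>R (s m + s n)"
    have "?w \<in> S"
      using s(1) assms(1) by (intro subspace_scale subspace_add)
    then have "d\<^sup>2 \<le> (norm (x - ?w))\<^sup>2"
      using d0 dle by (intro power_mono) auto
    moreover have "(norm (s m - s n))\<^sup>2 =
        2 * (norm (x - s m))\<^sup>2 + 2 * (norm (x - s n))\<^sup>2 - 4 * (norm (x - ?w))\<^sup>2"
      by (simp add: power2_norm_eq_inner inner_simps inner_commute algebra_simps)
    ultimately show ?thesis by simp
  qed
  have "Cauchy s"
  proof (rule metric_CauchyI)
    fix e :: real assume "e > 0"
    have "(\<lambda>n. (norm (x - s n))\<^sup>2) \<longlonglongrightarrow> d\<^sup>2" by (intro tendsto_intros lim)
    then have "\<forall>\<^sub>F n in sequentially. (norm (x - s n))\<^sup>2 < d\<^sup>2 + e\<^sup>2 / 4"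
      using \<open>e > 0\<close> by (intro order_tendstoD) auto
    then obtain M where M: "\<And>n. n \<ge> M \<Longrightarrow> (norm (x - s n))\<^sup>2 < d\<^sup>2 + e\<^sup>2 / 4"
      by (auto simp: eventually_sequentially)
    have "dist (s m) (s n) < e" if "m \<ge> M" "n \<ge> M" for m n
    proof -
      have "(norm (s m - s n))\<^sup>2 < e\<^sup>2"
        using par[of m n] M[OF that(1)] M[OF that(2)] by simp
      then show ?thesis using \<open>e > 0\<close> by (simp add: dist_norm power2_less_imp_less)
    qed
    then show "\<exists>M. \<forall>m\<ge>M. \<forall>n\<ge>M. dist (s m) (s n) < e" by blast
  qed
  then obtain l where l: "s \<longlonglongrightarrow> l" using Cauchy_convergent convergent_def by blast
  have lS: "l \<in> S" using closed_sequentially[OF assms(2)] s(1) l by blast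
  have "(\<lambda>n. norm (x - s n)) \<longlonglongrightarrow> norm (x - l)" by (intro tendsto_intros l)
  then have nl: "norm (x - l) = d" using lim LIMSEQ_unique by blast
  show thesis
  proof (rule that[of "x - l"])
    show "x - l \<noteq> 0" using x lS by auto
    fix u assume u: "u \<in> S"
    show "inner (x - l) u = 0"
    proof (cases "u = 0")
      case False
      \<comment> \<open>This \<open>t\<close> minimises the squared distance from \<open>x\<close>
        to the line \<open>l + t *\<^sub>R u\<close>; minimality of \<open>l\<close> then forces the
        gain \<open>(inner (x - l) u)\<^sup>2 / inner u u\<close> to vanish.\<close>
      define t where "t = inner (x - l) u / inner u u"
      have "l + t *\<^sub>R u \<in> S" using u lS assms(1) by (intro subspace_add subspace_scale)
      then have "d\<^sup>2 \<le> (norm (x - (l + t *\<^sub>R u)))\<^sup>2"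
        using d0 dle by (intro power_mono) auto
      also have "\<dots> = (norm (x - l))\<^sup>2 - 2 * t * inner (x - l) u + t\<^sup>2 * inner u u"
        by (simp add: power2_norm_eq_inner inner_simps inner_commute algebra_simps power2_eq_square[of t])
      also have "\<dots> = d\<^sup>2 - (inner (x - l) u)\<^sup>2 / inner u u"
        using False by (simp add: nl t_def power2_eq_square)
      finally have "(inner (x - l) u)\<^sup>2 / inner u u \<le> 0" by simp
      moreover have "inner u u > 0" using False by simp
      ultimately show ?thesis by (simp add: divide_le_0_iff)
    qed simp
  qed
qed

section \<open>Closures and adjoints of operators given by their graphs\<close>

lemma subspace_closure:
  fixes S :: "'h::real_normed_vector set"
  assumes "subspace S"
  shows "subspace (closure S)"
proof (rule subspaceI)
  show "0 \<in> closure S" using subspace_0[OF assms] closure_subset by blast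
  show "x + y \<in> closure S" if xy: "x \<in> closure S" "y \<in> closure S" for x y
  proof -
    obtain f g where "\<forall>n. f n \<in> S" "f \<longlonglongrightarrow> x" "\<forall>n. g n \<in> S" "g \<longlonglongrightarrow> y"
      using xy unfolding closure_sequential by blast
    then show ?thesis
      unfolding closure_sequential
      by (intro exI[of _ "\<lambda>n. f n + g n"] conjI allI tendsto_intros subspace_add[OF assms]) auto
  qed
  show "c *\<^sub>R x \<in> closure S" if x: "x \<in> closure S" for c x
  proof -
    obtain f where "\<forall>n. f n \<in> S" "f \<longlonglongrightarrow> x"
      using x unfolding closure_sequential by blast
    then show ?thesis
      unfolding closure_sequential
      by (intro exI[of _ "\<lambda>n. c *\<^sub>R f n"] conjI allI tendsto_intros subspace_scale[OF assms]) auto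
  qed
qed

lemma closed_adjoint_operator: "closed (adjoint_operator T)"
proof -
  have "adjoint_operator T = (\<Inter>(f, Tf)\<in>T. {p. inner Tf (fst p) = inner f (snd p)})"
    by (auto simp: adjoint_operator_def)
  moreover have "closed {p. inner Tf (fst p) = inner f (snd p)}" for f Tf :: 'a
    by (intro closed_Collect_eq continuous_intros)
  ultimately show ?thesis by (auto intro!: closed_INT)
qed

text \<open>For a fixed pair in the adjoint, the defining identity is a closed condition on
  \<open>(f, Tf)\<close>, so it passes to limits of graph elements.\<close>

lemma adjoint_operator_closure: "adjoint_operator (closure T) = adjoint_operator T"
proof
  show "adjoint_operator (closure T) \<subseteq> adjoint_operator T"
    using closure_subset[of T] unfolding adjoint_operator_def by blast
  show "adjoint_operator T \<subseteq> adjoint_operator (closure T)"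
  proof
    fix p assume p: "p \<in> adjoint_operator T"
    have "closure T \<subseteq> {q. inner (snd q) (fst p) = inner (fst q) (snd p)}"
      using p by (intro closure_minimal closed_Collect_eq continuous_intros)
        (auto simp: adjoint_operator_def)
    then show "p \<in> adjoint_operator (closure T)"
      by (auto simp: adjoint_operator_def)
  qed
qed

lemma closed_self_adjoint_operator: "self_adjoint_operator T \<Longrightarrow> closed T"
  using closed_adjoint_operator[of T] by (simp add: self_adjoint_operator_def)

lemma subspace_adjoint_operator: "subspace (adjoint_operator T)"
  by (rule subspaceI) (fastforce simp: adjoint_operator_def zero_prod_def inner_simps)+

text \<open>The difference of two values is orthogonal to the domain, hence by density to
  itself.\<close>

lemma single_valued_adjoint_operator:
  assumes "densely_defined T"
  shows "single_valued (adjoint_operator T)"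
proof (rule single_valuedI)
  fix g h h' assume gh: "(g, h) \<in> adjoint_operator T" "(g, h') \<in> adjoint_operator T"
  have "closure (Domain T) \<subseteq> {f. inner f (h - h') = 0}"
    using gh by (intro closure_minimal closed_Collect_eq continuous_intros)
      (fastforce simp: adjoint_operator_def inner_simps)
  moreover have "h - h' \<in> closure (Domain T)" using assms by (simp add: densely_defined_def)
  ultimately have "inner (h - h') (h - h') = 0" by blast
  then show "h = h'" by simp
qed

text \<open>Shifting by \<open>k - 1\<close> instead of \<open>k\<close> leaves a lower bound of 1.
  The shifted closure then has closed range, and \<open>ker\<close> makes this range everything,
  since a vector orthogonal to it solves the adjoint eigenvalue equation. Surjectivity forces the
  adjoint to coincide with the closure.\<close>

lemma essentially_self_adjoint_if_lower_bounded:
  fixes T :: "('h::{real_inner, complete_space} \<times> 'h) set"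
  assumes sym: "symmetric_operator T"
    and lower: "\<And>f Tf. (f, Tf) \<in> T \<Longrightarrow> inner Tf f \<ge> k * (norm f)\<^sup>2"
    and ker: "\<And>v. (v, (k - 1) *\<^sub>R v) \<in> adjoint_operator T \<Longrightarrow> v = 0"
  shows "essentially_self_adjoint T"
proof -
  have dense: "densely_defined T" and "subspace T"
    using sym by (auto simp: symmetric_operator_def linear_operator_def)
  have "T \<subseteq> adjoint_operator T"
    using sym by (fastforce simp: symmetric_operator_def adjoint_operator_def)
  then have cl_sub: "closure T \<subseteq> adjoint_operator T"
    by (rule closure_minimal) (rule closed_adjoint_operator)
  have sub: "subspace (closure T)" using \<open>subspace T\<close> by (rule subspace_closure)
  have "closure T \<subseteq> {q. k * (norm (fst q))\<^sup>2 \<le> inner (snd q) (fst q)}"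
    using lower by (intro closure_minimal closed_Collect_le continuous_intros) auto
  then have clower: "k * (norm f)\<^sup>2 \<le> inner p f" if "(f, p) \<in> closure T" for f p
    using that by auto
  have below: "norm f \<le> norm (p - (k - 1) *\<^sub>R f)" if "(f, p) \<in> closure T" for f p
  proof (cases "f = 0")
    case False
    have "norm f * norm f \<le> inner (p - (k - 1) *\<^sub>R f) f"
      using clower[OF that] by (simp add: inner_simps power2_norm_eq_inner[symmetric] algebra_simps power2_eq_square)
    also have "\<dots> \<le> norm (p - (k - 1) *\<^sub>R f) * norm f" by (rule norm_cauchy_schwarz)
    finally show ?thesis using False by simp
  qed simp
  \<comment> \<open>The shifted operator is a map on graph elements, so it makes sense on
    \<open>closure T\<close> before that set is known to be single-valued.\<close>
  define S :: "'h \<times> 'h \<Rightarrow> 'h" where "S = (\<lambda>q. snd q - (k - 1) *\<^sub>R fst q)"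
  have linS: "linear S"
    by (rule linearI) (auto simp: S_def algebra_simps)
  have "closed (S ` closure T)"
    unfolding closed_sequential_limits
  proof (intro allI impI, elim conjE)
    fix y l assume y: "\<forall>n. y n \<in> S ` closure T" and l: "y \<longlonglongrightarrow> l"
    then have "\<forall>n. \<exists>p. p \<in> closure T \<and> y n = S p" by blast
    then obtain q where q: "\<And>n. q n \<in> closure T" "\<And>n. y n = S (q n)" by metis
    \<comment> \<open>By \<open>below\<close>, convergence of the images controls the first
      components; the second components then converge because they equal
      \<open>y n + (k - 1) *\<^sub>R fst (q n)\<close>.\<close>
    have "Cauchy (\<lambda>n. fst (q n))"
    proof (rule metric_CauchyI)
      fix e :: real assume "e > 0"
      then obtain M where M: "\<And>m n. m \<ge> M \<Longrightarrow> n \<ge> M \<Longrightarrow> dist (y m) (y n) < e"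
        using LIMSEQ_imp_Cauchy[OF l] by (meson metric_CauchyD)
      have "dist (fst (q m)) (fst (q n)) \<le> dist (y m) (y n)" for m n
      proof -
        have "q m - q n \<in> closure T" using q(1) sub by (intro subspace_diff)
        then have "norm (fst (q m - q n)) \<le> norm (S (q m - q n))"
          unfolding S_def by (intro below) (simp only: prod.collapse)
        then show ?thesis by (simp add: dist_norm q(2) linear_diff[OF linS])
      qed
      then show "\<exists>M. \<forall>m\<ge>M. \<forall>n\<ge>M. dist (fst (q m)) (fst (q n)) < e"
        using M by (meson le_less_trans)
    qed
    then obtain f where f: "(\<lambda>n. fst (q n)) \<longlonglongrightarrow> f"
      using Cauchy_convergent convergent_def by blast
    have "(\<lambda>n. y n + (k - 1) *\<^sub>R fst (q n)) \<longlonglongrightarrow> l + (k - 1) *\<^sub>R f"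
      by (intro tendsto_intros l f)
    then have "(\<lambda>n. snd (q n)) \<longlonglongrightarrow> l + (k - 1) *\<^sub>R f"
      by (simp add: q(2) S_def)
    from tendsto_Pair[OF f this] have "q \<longlonglongrightarrow> (f, l + (k - 1) *\<^sub>R f)" by simp
    then have "(f, l + (k - 1) *\<^sub>R f) \<in> closure T"
      using closed_sequentially[OF closed_closure] q(1) by blast
    then show "l \<in> S ` closure T" by (rule rev_image_eqI) (simp add: S_def)
  qed
  moreover have "subspace (S ` closure T)" by (intro linear_subspace_image linS sub)
  ultimately have surj: "S ` closure T = UNIV"
  proof (rule_tac ccontr, rule_tac closed_subspace_orthogonal_vector[of "S ` closure T"])
    fix v assume v: "v \<noteq> 0" "\<And>s. s \<in> S ` closure T \<Longrightarrow> inner v s = 0"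
    have "(v, (k - 1) *\<^sub>R v) \<in> adjoint_operator T"
      using v(2) closure_subset[of T]
      by (force simp: adjoint_operator_def S_def inner_simps inner_commute)
    then show False using ker v(1) by blast
  qed
  have adj_cl: "adjoint_operator T = closure T"
  proof
    show "adjoint_operator T \<subseteq> closure T"
    proof
      fix r assume r: "r \<in> adjoint_operator T"
      \<comment> \<open>Any \<open>r\<close> in the adjoint has the same image under
        \<open>S\<close> as some \<open>q\<close> in the closure. The difference
        \<open>r - q\<close> is still in the adjoint and is killed by \<open>S\<close>, so
        \<open>ker\<close> gives \<open>r = q\<close>.\<close>
      obtain q where q: "q \<in> closure T" "S r = S q" using surj by (metis UNIV_I imageE)
      have "r - q \<in> adjoint_operator T"
        using r q(1) cl_sub subspace_adjoint_operator by (intro subspace_diff) auto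
      moreover have eq: "snd (r - q) = (k - 1) *\<^sub>R fst (r - q)"
        using q(2) by (simp add: S_def algebra_simps)
      ultimately have "fst (r - q) = 0" using ker by (metis prod.collapse)
      then have "r = q" using eq by (simp add: prod_eq_iff)
      then show "r \<in> closure T" using q(1) by simp
    qed
  qed (rule cl_sub)
  have "self_adjoint_operator (closure T)"
    unfolding self_adjoint_operator_def linear_operator_def
  proof (intro conjI)
    show "single_valued (closure T)"
      using single_valued_adjoint_operator[OF dense] adj_cl by simp
    have "closure (Domain T) \<subseteq> closure (Domain (closure T))"
      using closure_subset by (intro closure_mono) blast
    then show "densely_defined (closure T)"
      using dense by (auto simp: densely_defined_def)
    show "adjoint_operator (closure T) = closure T"
      by (simp add: adjoint_operator_closure adj_cl)
  qed (rule sub)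
  \<comment> \<open>Uniqueness: \<open>S'\<close> is closed and so contains the closure, while
    taking adjoints reverses the inclusion \<open>T \<subseteq> S'\<close> and bounds
    \<open>S'\<close> from above by the same set.\<close>
  moreover have "S' = closure T" if S': "self_adjoint_operator S'" "T \<subseteq> S'" for S'
  proof
    show "closure T \<subseteq> S'"
      using S'(2) closed_self_adjoint_operator[OF S'(1)] by (rule closure_minimal)
    have "S' = adjoint_operator S'" using S'(1) by (simp add: self_adjoint_operator_def)
    also have "\<dots> \<subseteq> adjoint_operator T" using S'(2) unfolding adjoint_operator_def by blast
    finally show "S' \<subseteq> closure T" using adj_cl by simp
  qed
  ultimately show ?thesis
    unfolding essentially_self_adjoint_def using sym closure_subset[of T] by blast
qed


section \<open>Finiteness of balls\<close>

lemma neighbours_commute: "y \<in> neighbours E x \<longleftrightarrow> x \<in> neighbours E y"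
  by (simp add: neighbours_def insert_commute)

lemma weighted_dist_le:
  assumes "\<forall>e\<in>E. a e > 0" "edge_path E x p y"
  shows "weighted_dist E a x y \<le> weighted_length a p"
  unfolding weighted_dist_def
proof (rule cInf_lower)
  show "bdd_below {weighted_length a p |p. edge_path E x p y}"
    using weighted_length_nonneg[OF assms(1)] by (intro bdd_belowI[of _ 0]) (auto simp: edge_path_def)
qed (use assms(2) in blast)

lemma weighted_dist_less_iff:
  assumes "connected_graph E" "\<forall>e\<in>E. a e > 0"
  shows "weighted_dist E a x y < r \<longleftrightarrow> (\<exists>p. edge_path E x p y \<and> weighted_length a p < r)"
proof
  have ne: "{weighted_length a p |p. edge_path E x p y} \<noteq> {}"
    using assms(1) by (auto simp: connected_graph_def)
  show "\<exists>p. edge_path E x p y \<and> weighted_length a p < r" if "weighted_dist E a x y < r"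
    using cInf_lessD[OF ne] that by (auto simp: weighted_dist_def)
qed (use weighted_dist_le[OF assms(2)] le_less_trans in blast)

lemma weighted_dist_edge_le:
  assumes "\<forall>e\<in>E. a e > 0" "y \<in> neighbours E x"
  shows "weighted_dist E a x y \<le> 1 / sqrt (a {x, y})"
  using weighted_dist_le[OF assms(1), of x "[x, y]" y] assms(2)
  by (simp add: edge_path_def neighbours_def)

text \<open>Splits off the first edge of an actual path shorter than \<open>r\<close>; such a path
  has at least one edge because its endpoints differ.\<close>

lemma weighted_dist_less_cases:
  assumes "connected_graph E" "\<forall>e\<in>E. a e > 0" "weighted_dist E a x y < r" "x \<noteq> y"
  obtains z where "z \<in> neighbours E x" "weighted_dist E a z y < r - 1 / sqrt (a {x, z})"
proof -
  obtain p where p: "edge_path E x p y" "weighted_length a p < r"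
    using assms(1-3) weighted_dist_less_iff by metis
  then obtain z q where q: "p = x # z # q"
    using \<open>x \<noteq> y\<close> unfolding edge_path_def
    by (cases p rule: weighted_length.cases[of "(a, p)" for p, simplified]) auto
  then have "z \<in> neighbours E x" "edge_path E z (z # q) y"
    using p(1) by (auto simp: edge_path_def neighbours_def)
  moreover have "weighted_length a (z # q) < r - 1 / sqrt (a {x, z})" using p(2) q by simp
  ultimately show thesis
    using that weighted_dist_less_iff[OF assms(1,2)] by blast
qed

text \<open>Every path leaving \<open>x\<close> pays for one of the finitely many edges at
  \<open>x\<close>, and these have a positive minimal length.\<close>

lemma weighted_dist_isolated:
  assumes "locally_finite_graph E" "connected_graph E" "\<forall>e\<in>E. a e > 0"
  obtains r where "r > 0" "\<And>y. weighted_dist E a x y < r \<Longrightarrow> y = x"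
proof -
  interpret Metric_space UNIV "weighted_dist E a"
    using assms by (rule weighted_dist_Metric_space)
  \<comment> \<open>The extra element 1 keeps \<open>L\<close> nonempty, so that
    \<open>Min L\<close> is meaningful even for a vertex without neighbours.\<close>
  define L where "L = insert 1 ((\<lambda>z. 1 / sqrt (a {x, z})) ` neighbours E x)"
  have fin: "finite L" using assms(1) by (simp add: L_def locally_finite_graph_def)
  show thesis
  proof (rule that)
    show "Min L > 0" using fin assms(3) by (auto simp: L_def neighbours_def)
    fix y assume d: "weighted_dist E a x y < Min L"
    show "y = x"
    proof (rule ccontr)
      assume "y \<noteq> x"
      then obtain z where z: "z \<in> neighbours E x" "weighted_dist E a z y < Min L - 1 / sqrt (a {x, z})"
        using weighted_dist_less_cases[OF assms(2,3) d] by metis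
      have "Min L \<le> 1 / sqrt (a {x, z})" using z(1) fin by (intro Min_le) (auto simp: L_def)
      with z(2) nonneg[of z y] show False by linarith
    qed
  qed
qed

text \<open>
  As in Koenig's lemma, an infinite ball yields an infinite edge path of finite length; it is a
  Cauchy sequence without limit since vertices are isolated.
\<close>

lemma finite_weighted_ball:
  assumes "simple_graph E" "locally_finite_graph E" "connected_graph E" "\<forall>e\<in>E. a e > 0"
    and complete: "Metric_space.mcomplete UNIV (weighted_dist E a)"
  shows "finite {y. weighted_dist E a x y < r}"
proof (rule ccontr)
  interpret Metric_space UNIV "weighted_dist E a"
    using assms(2-4) by (rule weighted_dist_Metric_space)
  let ?d = "weighted_dist E a"
  define B where "B = (\<lambda>(x, r). {y. ?d x y < r})"
  \<comment> \<open>A state is a centre with a remaining radius; crossing an edge uses up its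
    length.\<close>
  define step where "step = (\<lambda>(x, r) (z, s). z \<in> neighbours E x \<and> s = r - 1 / sqrt (a {x, z}))"
  assume "infinite {y. ?d x y < r}"
  then have start: "infinite (B (x, r))" by (simp add: B_def)
  have next_ex: "\<exists>q. infinite (B q) \<and> step p q" if "infinite (B p)" for p
  proof -
    obtain x r where p: "p = (x, r)" by fastforce
    \<comment> \<open>The ball is covered by its centre and finitely many smaller balls around the
      neighbours, one of which must again be infinite.\<close>
    have "B p \<subseteq> insert x (\<Union>z\<in>neighbours E x. B (z, r - 1 / sqrt (a {x, z})))"
    proof
      fix y assume "y \<in> B p"
      then show "y \<in> insert x (\<Union>z\<in>neighbours E x. B (z, r - 1 / sqrt (a {x, z})))"
        using weighted_dist_less_cases[OF assms(3,4), of x y r] by (cases "y = x") (auto simp: p B_def)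
    qed
    then have "infinite (\<Union>z\<in>neighbours E x. B (z, r - 1 / sqrt (a {x, z})))"
      using that finite_subset by auto
    then show ?thesis
      using assms(2) by (auto simp: p step_def locally_finite_graph_def)
  qed
  obtain q where q0: "\<And>n. infinite (B (q n))" "\<And>n. step (q n) (q (Suc n))"
    using dependent_nat_choice[of "\<lambda>_ p. infinite (B p)" "\<lambda>_. step"] start next_ex by metis
  define u s where "u n = fst (q n)" and "s n = snd (q n)" for n
  have nb: "u (Suc n) \<in> neighbours E (u n)" and sSuc: "s (Suc n) = s n - 1 / sqrt (a {u n, u (Suc n)})" for n
    using q0(2)[of n] by (auto simp: step_def u_def s_def split: prod.splits)
  \<comment> \<open>Balls of negative radius are empty, so the remaining radius never becomes
    negative and the whole path has length at most \<open>s 0\<close>.\<close>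
  have spos: "s n \<ge> 0" for n
  proof (rule ccontr)
    assume "\<not> s n \<ge> 0"
    then have "B (q n) = {}"
      using nonneg le_less_trans[OF nonneg] by (fastforce simp: B_def s_def split: prod.splits)
    then show False using q0(1)[of n] by simp
  qed
  have dstep: "?d (u n) (u (Suc n)) \<le> s n - s (Suc n)" for n
    using weighted_dist_edge_le[OF assms(4) nb] sSuc[of n] by simp
  have "decseq s"
  proof (rule decseq_SucI)
    show "s (Suc n) \<le> s n" for n using dstep[of n] nonneg[of "u n" "u (Suc n)"] by linarith
  qed
  then obtain L where "s \<longlonglongrightarrow> L"
    using decseq_convergent[of s 0] spos by blast
  then have "Cauchy s" by (rule LIMSEQ_imp_Cauchy)
  have dle: "?d (u m) (u (m + j)) \<le> s m - s (m + j)" for m j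
  proof (induction j)
    case (Suc j)
    then show ?case using triangle[of "u m" "u (m + j)" "u (m + Suc j)"] dstep[of "m + j"] by simp
  qed simp
  have "MCauchy u"
    unfolding MCauchy_def
  proof (intro conjI allI impI)
    fix e :: real assume "e > 0"
    then obtain M where M: "\<And>m n. m \<ge> M \<Longrightarrow> n \<ge> M \<Longrightarrow> dist (s m) (s n) < e"
      using \<open>Cauchy s\<close> by (meson metric_CauchyD)
    have le: "?d (u m) (u n) < e" if "m \<ge> M" "m \<le> n" for m n
      using dle[of m "n - m"] M[of m n] that by (auto simp: dist_real_def)
    have "?d (u m) (u n) < e" if "m \<ge> M" "n \<ge> M" for m n
      using le[of m n] le[of n m] that commute[of "u m" "u n"] by (cases "m \<le> n") auto
    then show "\<exists>N. \<forall>n n'. N \<le> n \<longrightarrow> N \<le> n' \<longrightarrow> ?d (u n) (u n') < e" by blast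
  qed simp
  then obtain l where l: "limitin mtopology u l sequentially"
    using complete by (auto simp: mcomplete_def)
  obtain e where e: "e > 0" "\<And>y. ?d l y < e \<Longrightarrow> y = l"
    using weighted_dist_isolated[OF assms(2-4)] by metis
  have "\<forall>\<^sub>F n in sequentially. ?d (u n) l < e"
    using l e(1) by (auto simp: limitin_metric)
  then obtain M where M: "\<And>n. n \<ge> M \<Longrightarrow> ?d (u n) l < e" by (auto simp: eventually_sequentially)
  \<comment> \<open>Two consecutive vertices of the path coincide with the isolated limit, which
    would make a loop at \<open>l\<close> an edge.\<close>
  then have "u M = l" "u (Suc M) = l" using e(2) commute by (metis le_refl, metis le_SucI le_refl)
  then have "{l, l} \<in> E" using nb[of M] by (simp add: neighbours_def)
  then show False using assms(1) by (auto simp: simple_graph_def doubleton_eq_iff)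
qed


section \<open>The Schroedinger operator\<close>

text \<open>Moves neighbour sums to one set \<open>F\<close> that does not depend on
  \<open>x\<close>, so that double sums can be interchanged.\<close>

lemma sum_neighbours_eq:
  fixes c :: "'v \<Rightarrow> real"
  assumes "finite F" "finite (neighbours E x)" "\<And>y. y \<in> neighbours E x \<Longrightarrow> y \<notin> F \<Longrightarrow> c y = 0"
  shows "(\<Sum>y\<in>neighbours E x. c y) = (\<Sum>y\<in>F. if y \<in> neighbours E x then c y else 0)"
  using assms
  by (simp add: sum.inter_restrict[symmetric]) (rule sum.mono_neutral_right, auto)

text \<open>Separates the diagonal of the operator from its symmetric off-diagonal part.\<close>

lemma schroedinger_alt:
  "schroedinger E a W f x =
     ((\<Sum>y\<in>neighbours E x. a {x, y}) + W x) * f x - (\<Sum>y\<in>neighbours E x. a {x, y} * f y)"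
  by (simp add: schroedinger_def algebra_simps sum_subtractf sum_distrib_left)

lemma schroedinger_add:
  "schroedinger E a W (\<lambda>x. f x + g x) x = schroedinger E a W f x + schroedinger E a W g x"
  by (simp add: schroedinger_alt algebra_simps sum.distrib)

lemma schroedinger_scale:
  "schroedinger E a W (\<lambda>x. c * f x) x = c * schroedinger E a W f x"
  by (simp add: schroedinger_alt algebra_simps sum_distrib_left)

text \<open>Green's formula: the matrix \<open>b\<close> is symmetric, and \<open>F\<close> contains
  the support of \<open>f\<close> with all its neighbours, so no boundary term appears. The function
  \<open>v\<close> is arbitrary, which allows testing against elements of the adjoint.\<close>

lemma schroedinger_green:
  assumes lf: "locally_finite_graph E" and "finite F"
    and supp: "\<And>x. f x \<noteq> 0 \<Longrightarrow> x \<in> F \<and> neighbours E x \<subseteq> F"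
  shows "(\<Sum>x\<in>F. schroedinger E a W f x * v x) = (\<Sum>x\<in>F. f x * schroedinger E a W v x)"
proof -
  define D where "D x = (\<Sum>y\<in>neighbours E x. a {x, y}) + W x" for x
  define b where "b x y = (if y \<in> neighbours E x then a {x, y} else 0)" for x y
  have fin: "finite (neighbours E x)" for x using lf by (simp add: locally_finite_graph_def)
  have bsym: "b x y = b y x" for x y
    using neighbours_commute[of y E x] by (simp add: b_def insert_commute)
  have 1: "schroedinger E a W f x = D x * f x - (\<Sum>y\<in>F. b x y * f y)" for x
    using sum_neighbours_eq[OF \<open>finite F\<close> fin, of x "\<lambda>y. a {x, y} * f y"] supp
    by (auto simp: schroedinger_alt D_def b_def if_distrib[of "\<lambda>c. c * _"] cong: if_cong)
  \<comment> \<open>Since \<open>v\<close> may be nonzero outside \<open>F\<close>, the neighbour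
    sum is replaced only where \<open>f x\<close> is nonzero and all neighbours lie in
    \<open>F\<close>; elsewhere both sides vanish.\<close>
  have 2: "f x * schroedinger E a W v x = f x * (D x * v x) - f x * (\<Sum>y\<in>F. b x y * v y)" for x
  proof (cases "f x = 0")
    case False
    then show ?thesis
      using sum_neighbours_eq[OF \<open>finite F\<close> fin, of x "\<lambda>y. a {x, y} * v y"] supp[of x]
      by (auto simp: schroedinger_alt D_def b_def if_distrib[of "\<lambda>c. c * _"] right_diff_distrib cong: if_cong)
  qed simp
  have "(\<Sum>x\<in>F. (\<Sum>y\<in>F. b x y * f y) * v x) = (\<Sum>x\<in>F. \<Sum>y\<in>F. b x y * f y * v x)"
    by (simp add: sum_distrib_right)
  also have "\<dots> = (\<Sum>y\<in>F. \<Sum>x\<in>F. b x y * f y * v x)" by (rule sum.swap)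
  also have "\<dots> = (\<Sum>y\<in>F. f y * (\<Sum>x\<in>F. b y x * v x))"
    by (simp add: sum_distrib_left bsym mult_ac)
  finally have swap: "(\<Sum>x\<in>F. (\<Sum>y\<in>F. b x y * f y) * v x) = (\<Sum>x\<in>F. f x * (\<Sum>y\<in>F. b x y * v y))" .
  have "(\<Sum>x\<in>F. D x * f x * v x) = (\<Sum>x\<in>F. f x * (D x * v x))" by (simp add: mult_ac)
  with swap show ?thesis
    unfolding 1 2 left_diff_distrib sum_subtractf by simp
qed

text \<open>A localisation identity: subtracting \<open>\<phi> x\<close> times the eigenvalue
  equation cancels \<open>W\<close> and all terms in \<open>v x\<close>, leaving only differences of
  \<open>\<phi>\<close>.\<close>

lemma schroedinger_cutoff:
  fixes \<phi> :: "'v \<Rightarrow> real"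
  assumes lf: "locally_finite_graph E" and "finite F"
    and supp: "\<And>x. \<phi> x \<noteq> 0 \<Longrightarrow> x \<in> F \<and> neighbours E x \<subseteq> F"
    and eig: "\<And>x. schroedinger E a W v x = c * v x"
  shows "(\<Sum>x\<in>F. (schroedinger E a W (\<lambda>x. \<phi> x * v x) x - c * (\<phi> x * v x)) * (\<phi> x * v x)) =
    1 / 2 * (\<Sum>x\<in>F. \<Sum>y\<in>F. if y \<in> neighbours E x then a {x, y} * (\<phi> x - \<phi> y)\<^sup>2 * (v x * v y) else 0)"
proof -
  define b where "b x y = (if y \<in> neighbours E x then a {x, y} else 0)" for x y
  have fin: "finite (neighbours E x)" for x using lf by (simp add: locally_finite_graph_def)
  have bsym: "b x y = b y x" for x y
    using neighbours_commute[of y E x] by (simp add: b_def insert_commute)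
  have 1: "(schroedinger E a W (\<lambda>x. \<phi> x * v x) x - c * (\<phi> x * v x)) * (\<phi> x * v x) =
     (\<Sum>y\<in>F. b x y * (v x * v y) * (\<phi> x * (\<phi> x - \<phi> y)))" for x
  proof (cases "\<phi> x = 0")
    case False
    have "schroedinger E a W (\<lambda>x. \<phi> x * v x) x - c * (\<phi> x * v x) =
        schroedinger E a W (\<lambda>x. \<phi> x * v x) x - \<phi> x * schroedinger E a W v x"
      by (simp add: eig)
    also have "\<dots> = (\<Sum>y\<in>neighbours E x. a {x, y} * v y * (\<phi> x - \<phi> y))"
      by (simp add: schroedinger_def algebra_simps sum_subtractf sum.distrib sum_distrib_left)
    also have "\<dots> = (\<Sum>y\<in>F. b x y * v y * (\<phi> x - \<phi> y))"
      using sum_neighbours_eq[OF \<open>finite F\<close> fin, of x "\<lambda>y. a {x, y} * v y * (\<phi> x - \<phi> y)"] supp[OF False]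
      by (auto simp: b_def if_distrib[of "\<lambda>c. c * _"] cong: if_cong)
    finally show ?thesis by (simp add: sum_distrib_right sum_distrib_left mult_ac)
  qed simp
  let ?S = "\<Sum>x\<in>F. \<Sum>y\<in>F. b x y * (v x * v y) * (\<phi> x * (\<phi> x - \<phi> y))"
  \<comment> \<open>Averaging with the interchanged sum uses that
    \<open>\<phi> x * (\<phi> x - \<phi> y)\<close> and its mirror image add up to
    \<open>(\<phi> x - \<phi> y)\<^sup>2\<close>.\<close>
  have "?S = (\<Sum>x\<in>F. \<Sum>y\<in>F. b y x * (v y * v x) * (\<phi> y * (\<phi> y - \<phi> x)))" by (rule sum.swap)
  then have "2 * ?S = (\<Sum>x\<in>F. \<Sum>y\<in>F. b x y * (v x * v y) * (\<phi> x * (\<phi> x - \<phi> y)) +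
       b y x * (v y * v x) * (\<phi> y * (\<phi> y - \<phi> x)))"
    by (simp add: sum.distrib)
  also have "\<dots> = (\<Sum>x\<in>F. \<Sum>y\<in>F. b x y * (\<phi> x - \<phi> y)\<^sup>2 * (v x * v y))"
    by (intro sum.cong refl) (simp add: bsym[of _ _] power2_eq_square algebra_simps)
  finally show ?thesis
    unfolding 1 by (simp add: b_def if_distrib[of "\<lambda>c. c * _"] cong: if_cong)
qed

section \<open>The operator on \<open>C0\<close> inside the Hilbert space\<close>

lemma l2_eqI: "(\<And>x. l2_fun f x = l2_fun g x) \<Longrightarrow> f = g"
  using l2_fun_inject by blast

lemma l2_fun_Abs_C0: "f \<in> C0 \<Longrightarrow> l2_fun (Abs_l2 f) = f"
  by (simp add: Abs_l2_inverse C0_square_summable)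

lemma inner_Abs_C0:
  assumes "f \<in> C0" "finite F" "\<And>x. f x \<noteq> 0 \<Longrightarrow> x \<in> F"
  shows "inner (Abs_l2 f) g = (\<Sum>x\<in>F. f x * l2_fun g x)"
proof -
  have "inner (Abs_l2 f) g = (\<Sum>\<^sub>\<infinity>x\<in>F. f x * l2_fun g x)"
    unfolding inner_l2.rep_eq l2_fun_Abs_C0[OF assms(1)]
    by (rule infsum_cong_neutral) (use assms(3) in auto)
  then show ?thesis using assms(2) by simp
qed

lemma finite_support_neighbourhood:
  assumes "locally_finite_graph E" "f \<in> C0"
  obtains F where "finite F" "\<And>x. f x \<noteq> 0 \<Longrightarrow> x \<in> F \<and> neighbours E x \<subseteq> F"
    "\<And>a W x. schroedinger E a W f x \<noteq> 0 \<Longrightarrow> x \<in> F"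
proof (rule that)
  let ?F = "{x. f x \<noteq> 0} \<union> (\<Union>x\<in>{x. f x \<noteq> 0}. neighbours E x)"
  show "finite ?F" using assms by (simp add: C0_def locally_finite_graph_def)
  show "x \<in> ?F \<and> neighbours E x \<subseteq> ?F" if "f x \<noteq> 0" for x using that by blast
  show "x \<in> ?F" if "schroedinger E a W f x \<noteq> 0" for a W x
  proof (rule ccontr)
    assume "x \<notin> ?F"
    then have "f x = 0" "\<And>y. y \<in> neighbours E x \<Longrightarrow> f y = 0"
      using neighbours_commute[of _ E x] by auto
    then show False using that by (simp add: schroedinger_def)
  qed
qed

text \<open>The right-hand side is a finite sum and not an inner product, because
  \<open>schroedinger E a W (l2_fun g)\<close> need not be square-summable.\<close>

lemma inner_schroedinger_C0:
  assumes "locally_finite_graph E" "f \<in> C0" "finite F"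
    "\<And>x. f x \<noteq> 0 \<Longrightarrow> x \<in> F \<and> neighbours E x \<subseteq> F"
    "\<And>x. schroedinger E a W f x \<noteq> 0 \<Longrightarrow> x \<in> F"
  shows "inner (Abs_l2 (schroedinger E a W f)) g = (\<Sum>x\<in>F. f x * schroedinger E a W (l2_fun g) x)"
  using inner_Abs_C0[OF schroedinger_C0[OF assms(1,2)] assms(3,5)] schroedinger_green[OF assms(1,3,4)]
  by simp

text \<open>Testing with the indicator function of the vertex \<open>x\<close> shows that the
  adjoint acts by the same difference formula. An abstract eigenvector of the adjoint thereby
  satisfies a pointwise equation.\<close>

lemma adjoint_schroedinger_operator:
  assumes "locally_finite_graph E" "(g, h) \<in> adjoint_operator (schroedinger_operator E a W)"
  shows "schroedinger E a W (l2_fun g) x = l2_fun h x"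
proof -
  define f :: "'a \<Rightarrow> real" where "f y = (if y = x then 1 else 0)" for y
  have f: "f \<in> C0" by (simp add: C0_def f_def)
  obtain F where F: "finite F" "\<And>x. f x \<noteq> 0 \<Longrightarrow> x \<in> F \<and> neighbours E x \<subseteq> F"
    "\<And>x. schroedinger E a W f x \<noteq> 0 \<Longrightarrow> x \<in> F"
    using finite_support_neighbourhood[OF assms(1) f] by metis
  have "x \<in> F" using F(2)[of x] by (simp add: f_def)
  have "inner (Abs_l2 (schroedinger E a W f)) g = inner (Abs_l2 f) h"
    using assms(2) f by (auto simp: adjoint_operator_def schroedinger_operator_def)
  then have "(\<Sum>x\<in>F. f x * schroedinger E a W (l2_fun g) x) = (\<Sum>x\<in>F. f x * l2_fun h x)"
    using inner_schroedinger_C0[OF assms(1) f F] inner_Abs_C0[OF f F(1)] F(2) by metis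
  then show ?thesis
    using \<open>x \<in> F\<close> F(1) by (simp add: f_def if_distrib[of "\<lambda>c. c * _"] sum.delta cong: if_cong)
qed

lemma subspace_schroedinger_operator:
  assumes "locally_finite_graph E"
  shows "subspace (schroedinger_operator E a W)"
proof (rule subspaceI)
  note C0 = l2_fun_Abs_C0 schroedinger_C0[OF assms]
  have zero: "(\<lambda>_. 0) \<in> C0" by (simp add: C0_def)
  have add: "(\<lambda>x. f x + g x) \<in> C0" if "f \<in> C0" "g \<in> C0" for f g :: "'a \<Rightarrow> real"
    using that by (auto simp: C0_def intro: finite_subset[of _ "{x. f x \<noteq> 0} \<union> {x. g x \<noteq> 0}"])
  have scale: "(\<lambda>x. c * f x) \<in> C0" if "f \<in> C0" for c and f :: "'a \<Rightarrow> real"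
    using that by (auto simp: C0_def intro: finite_subset[of _ "{x. f x \<noteq> 0}"])
  have "Abs_l2 (schroedinger E a W (\<lambda>_. 0)) = 0" "Abs_l2 (\<lambda>_. 0) = (0 :: 'a l2)"
    by (auto intro!: l2_eqI simp: C0 zero zero_l2.rep_eq) (simp add: schroedinger_def)
  then show "0 \<in> schroedinger_operator E a W"
    unfolding schroedinger_operator_def zero_prod_def using zero by force
  show "p + q \<in> schroedinger_operator E a W"
    if pq: "p \<in> schroedinger_operator E a W" "q \<in> schroedinger_operator E a W" for p q
  proof -
    obtain f g where f: "f \<in> C0" "p = (Abs_l2 f, Abs_l2 (schroedinger E a W f))"
      and g: "g \<in> C0" "q = (Abs_l2 g, Abs_l2 (schroedinger E a W g))"
      using pq by (auto simp: schroedinger_operator_def)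
    let ?h = "\<lambda>x. f x + g x"
    have "p + q = (Abs_l2 ?h, Abs_l2 (schroedinger E a W ?h))"
      by (auto intro!: l2_eqI simp: f g C0 add plus_l2.rep_eq schroedinger_add)
    then show ?thesis using add[OF f(1) g(1)] by (auto simp: schroedinger_operator_def)
  qed
  show "c *\<^sub>R p \<in> schroedinger_operator E a W" if p: "p \<in> schroedinger_operator E a W" for c p
  proof -
    obtain f where f: "f \<in> C0" "p = (Abs_l2 f, Abs_l2 (schroedinger E a W f))"
      using p by (auto simp: schroedinger_operator_def)
    let ?h = "\<lambda>x. c * f x"
    have "c *\<^sub>R p = (Abs_l2 ?h, Abs_l2 (schroedinger E a W ?h))"
      by (auto intro!: l2_eqI simp: f C0 scale scaleR_l2.rep_eq schroedinger_scale)
    then show ?thesis using scale[OF f(1)] by (auto simp: schroedinger_operator_def)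
  qed
qed

text \<open>A vector orthogonal to the domain is orthogonal to the indicator function of every
  vertex, hence zero.\<close>

lemma densely_defined_schroedinger_operator:
  assumes "locally_finite_graph E"
  shows "densely_defined (schroedinger_operator E a W)"
  unfolding densely_defined_def
proof (rule ccontr)
  let ?D = "Domain (schroedinger_operator E a W)"
  assume ne: "closure ?D \<noteq> UNIV"
  have "subspace (closure ?D)"
    unfolding Domain_fst using subspace_schroedinger_operator[OF assms]
    by (intro subspace_closure linear_subspace_image bounded_linear.linear bounded_linear_fst)
  then obtain v where v: "v \<noteq> 0" "\<And>s. s \<in> closure ?D \<Longrightarrow> inner v s = 0"
    using closed_subspace_orthogonal_vector[OF _ closed_closure ne] by metis
  have "l2_fun v x = l2_fun 0 x" for x
  proof -
    define f :: "'a \<Rightarrow> real" where "f y = (if y = x then 1 else 0)" for y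
    have f: "f \<in> C0" by (simp add: C0_def f_def)
    then have "Abs_l2 f \<in> ?D" by (auto simp: schroedinger_operator_def)
    then have "inner (Abs_l2 f) v = 0"
      using v(2) closure_subset[of ?D] by (metis inner_commute subsetD)
    moreover have "inner (Abs_l2 f) v = (\<Sum>y\<in>{x}. f y * l2_fun v y)"
      by (rule inner_Abs_C0[OF f]) (auto simp: f_def split: if_splits)
    ultimately show ?thesis by (simp add: f_def zero_l2.rep_eq)
  qed
  then have "v = 0" by (rule l2_eqI)
  with v(1) show False by simp
qed

lemma symmetric_schroedinger_operator:
  assumes "locally_finite_graph E"
  shows "symmetric_operator (schroedinger_operator E a W)"
  unfolding symmetric_operator_def linear_operator_def
proof (intro conjI subspace_schroedinger_operator densely_defined_schroedinger_operator assms)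
  show "single_valued (schroedinger_operator E a W)"
    by (rule single_valuedI) (auto simp: schroedinger_operator_def dest!: arg_cong[of _ _ l2_fun]
        simp: l2_fun_Abs_C0)
  have "inner (Abs_l2 (schroedinger E a W f)) (Abs_l2 g) = inner (Abs_l2 f) (Abs_l2 (schroedinger E a W g))"
    if f: "f \<in> C0" and g: "g \<in> C0" for f g
  proof -
    obtain F where F: "finite F" "\<And>x. f x \<noteq> 0 \<Longrightarrow> x \<in> F \<and> neighbours E x \<subseteq> F"
      "\<And>x. schroedinger E a W f x \<noteq> 0 \<Longrightarrow> x \<in> F"
      using finite_support_neighbourhood[OF assms f] by metis
    have "inner (Abs_l2 (schroedinger E a W f)) (Abs_l2 g) = (\<Sum>x\<in>F. f x * schroedinger E a W g x)"
      using inner_schroedinger_C0[OF assms f F, where g = "Abs_l2 g"] by (simp add: l2_fun_Abs_C0 g)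
    also have "\<dots> = (\<Sum>x\<in>F. f x * l2_fun (Abs_l2 (schroedinger E a W g)) x)"
      by (simp only: l2_fun_Abs_C0[OF schroedinger_C0[OF assms g]])
    also have "\<dots> = inner (Abs_l2 f) (Abs_l2 (schroedinger E a W g))"
      by (rule inner_Abs_C0[symmetric, OF f F(1)]) (use F(2) in blast)
    finally show ?thesis .
  qed
  then show "\<forall>(f, Tf)\<in>schroedinger_operator E a W. \<forall>(g, Tg)\<in>schroedinger_operator E a W.
      inner Tf g = inner f Tg"
    by (auto simp: schroedinger_operator_def)
qed

section \<open>The cutoff argument\<close>

text \<open>Bounded degree enters here: after \<open>v x * v y\<close> is bounded by the mean of the
  two squares, each vertex contributes its square at most \<open>N\<close> times.\<close>

lemma cutoff_energy_le:
  fixes \<phi> :: "'v \<Rightarrow> real" and v :: "'v l2"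
  assumes "finite F" and deg: "\<And>x. finite (neighbours E x) \<and> card (neighbours E x) \<le> N"
    and nonneg: "\<And>x y. y \<in> neighbours E x \<Longrightarrow> a {x, y} \<ge> 0"
    and lip: "\<And>x y. y \<in> neighbours E x \<Longrightarrow> a {x, y} * (\<phi> x - \<phi> y)\<^sup>2 \<le> \<epsilon>\<^sup>2"
  shows "(\<Sum>x\<in>F. \<Sum>y\<in>F. if y \<in> neighbours E x
      then a {x, y} * (\<phi> x - \<phi> y)\<^sup>2 * (l2_fun v x * l2_fun v y) else 0) \<le> \<epsilon>\<^sup>2 * N * (norm v)\<^sup>2"
proof -
  let ?v = "l2_fun v"
  define A where "A x y = (if y \<in> neighbours E x then 1 else 0 :: real)" for x y
  have Asym: "A x y = A y x" for x y using neighbours_commute[of y E x] by (simp add: A_def)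
  have "(\<Sum>x\<in>F. \<Sum>y\<in>F. if y \<in> neighbours E x then a {x, y} * (\<phi> x - \<phi> y)\<^sup>2 * (?v x * ?v y) else 0)
     \<le> (\<Sum>x\<in>F. \<Sum>y\<in>F. \<epsilon>\<^sup>2 / 2 * (A x y * (?v x)\<^sup>2) + \<epsilon>\<^sup>2 / 2 * (A x y * (?v y)\<^sup>2))"
  proof (intro sum_mono)
    fix x y
    have AG: "\<bar>?v x * ?v y\<bar> \<le> ((?v x)\<^sup>2 + (?v y)\<^sup>2) / 2"
      using sum_squares_bound[of "\<bar>?v x\<bar>" "\<bar>?v y\<bar>"] by (simp add: abs_mult)
    have "a {x, y} * (\<phi> x - \<phi> y)\<^sup>2 * (?v x * ?v y) \<le> \<epsilon>\<^sup>2 * (((?v x)\<^sup>2 + (?v y)\<^sup>2) / 2)"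
      if y: "y \<in> neighbours E x"
    proof -
      have "a {x, y} * (\<phi> x - \<phi> y)\<^sup>2 * (?v x * ?v y) \<le> a {x, y} * (\<phi> x - \<phi> y)\<^sup>2 * \<bar>?v x * ?v y\<bar>"
        using nonneg[OF y] by (intro mult_left_mono) auto
      also have "\<dots> \<le> \<epsilon>\<^sup>2 * (((?v x)\<^sup>2 + (?v y)\<^sup>2) / 2)"
        using lip[OF y] AG by (intro mult_mono) auto
      finally show ?thesis .
    qed
    then show "(if y \<in> neighbours E x then a {x, y} * (\<phi> x - \<phi> y)\<^sup>2 * (?v x * ?v y) else 0)
      \<le> \<epsilon>\<^sup>2 / 2 * (A x y * (?v x)\<^sup>2) + \<epsilon>\<^sup>2 / 2 * (A x y * (?v y)\<^sup>2)"
      by (simp add: A_def field_simps)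
  qed
  also have "\<dots> = \<epsilon>\<^sup>2 / 2 * (\<Sum>x\<in>F. \<Sum>y\<in>F. A x y * (?v x)\<^sup>2) + \<epsilon>\<^sup>2 / 2 * (\<Sum>x\<in>F. \<Sum>y\<in>F. A x y * (?v y)\<^sup>2)"
    by (simp add: sum.distrib sum_distrib_left)
  \<comment> \<open>By symmetry of adjacency both halves are the same sum, so the two factors 1/2
    add up to 1.\<close>
  also have "(\<Sum>x\<in>F. \<Sum>y\<in>F. A x y * (?v y)\<^sup>2) = (\<Sum>x\<in>F. \<Sum>y\<in>F. A x y * (?v x)\<^sup>2)"
    by (subst sum.swap) (simp add: Asym)
  finally have le: "(\<Sum>x\<in>F. \<Sum>y\<in>F. if y \<in> neighbours E x then a {x, y} * (\<phi> x - \<phi> y)\<^sup>2 * (?v x * ?v y) else 0)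
     \<le> \<epsilon>\<^sup>2 * (\<Sum>x\<in>F. \<Sum>y\<in>F. A x y * (?v x)\<^sup>2)" by simp
  have "(\<Sum>x\<in>F. \<Sum>y\<in>F. A x y * (?v x)\<^sup>2) \<le> (\<Sum>x\<in>F. N * (?v x)\<^sup>2)"
  proof (rule sum_mono)
    fix x
    have "(\<Sum>y\<in>F. A x y) = card (F \<inter> neighbours E x)"
      using \<open>finite F\<close> by (simp add: A_def sum.inter_restrict[symmetric])
    also have "\<dots> \<le> N"
      using deg[of x] card_mono[of "neighbours E x" "F \<inter> neighbours E x"] by force
    finally show "(\<Sum>y\<in>F. A x y * (?v x)\<^sup>2) \<le> N * (?v x)\<^sup>2"
      by (simp add: sum_distrib_right[symmetric] mult_right_mono)
  qed
  also have "\<dots> \<le> N * (norm v)\<^sup>2"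
    using sum_le_norm_l2[OF \<open>finite F\<close>, of v] by (simp add: sum_distrib_left[symmetric] mult_left_mono)
  finally have "\<epsilon>\<^sup>2 * (\<Sum>x\<in>F. \<Sum>y\<in>F. A x y * (?v x)\<^sup>2) \<le> \<epsilon>\<^sup>2 * (N * (norm v)\<^sup>2)"
    by (rule mult_left_mono) simp
  with le show ?thesis by (simp add: mult.assoc)
qed

lemma schroedinger_eigenvector_eq_0:
  fixes v :: "'v l2"
  assumes graph: "simple_graph E" "locally_finite_graph E" "connected_graph E" "bounded_degree E"
    and pos: "\<forall>e\<in>E. a e > 0"
    and complete: "Metric_space.mcomplete UNIV (weighted_dist E a)"
    and lower: "\<And>g. g \<in> C0 \<Longrightarrow>
      inner (Abs_l2 (schroedinger E a W g)) (Abs_l2 g) \<ge> k * (norm (Abs_l2 g))\<^sup>2"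
    and eig: "\<And>x. schroedinger E a W (l2_fun v) x = (k - 1) * l2_fun v x"
  shows "v = 0"
proof (rule l2_eqI)
  fix z
  interpret Metric_space UNIV "weighted_dist E a"
    using graph(2,3) pos by (rule weighted_dist_Metric_space)
  let ?d = "weighted_dist E a" and ?v = "l2_fun v"
  obtain N where N: "\<And>x. finite (neighbours E x) \<and> card (neighbours E x) \<le> N"
    using graph(4) by (auto simp: bounded_degree_def)
  have est: "(?v z)\<^sup>2 \<le> \<epsilon>\<^sup>2 * (N * (norm v)\<^sup>2 / 2)" if "\<epsilon> > 0" for \<epsilon>
  proof -
    \<comment> \<open>The cutoff equals 1 at \<open>z\<close> for every \<epsilon>, so the value of
      \<open>v\<close> at \<open>z\<close> survives, and it vanishes from distance
      \<open>1 / \<epsilon>\<close> on.\<close>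
    define \<phi> where "\<phi> x = max 0 (1 - \<epsilon> * ?d z x)" for x
    have lip: "a {x, y} * (\<phi> x - \<phi> y)\<^sup>2 \<le> \<epsilon>\<^sup>2" if y: "y \<in> neighbours E x" for x y
    proof -
      have a: "a {x, y} > 0" using y pos by (simp add: neighbours_def)
      have "\<bar>\<epsilon> * ?d z x - \<epsilon> * ?d z y\<bar> = \<epsilon> * \<bar>?d z x - ?d z y\<bar>"
        using \<open>\<epsilon> > 0\<close> by (simp add: right_diff_distrib[symmetric] abs_mult)
      also have "\<bar>?d z x - ?d z y\<bar> \<le> ?d x y"
        using triangle[of z x y] triangle[of z y x] commute[of x y] by simp
      also have "?d x y \<le> 1 / sqrt (a {x, y})" by (rule weighted_dist_edge_le[OF pos y])
      finally have "\<bar>\<phi> x - \<phi> y\<bar> \<le> \<epsilon> * (1 / sqrt (a {x, y}))"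
        using \<open>\<epsilon> > 0\<close> by (auto simp: \<phi>_def)
      then have "(\<phi> x - \<phi> y)\<^sup>2 \<le> (\<epsilon> * (1 / sqrt (a {x, y})))\<^sup>2"
        by (rule power2_le_iff_abs_le[THEN iffD2, rotated]) (use \<open>\<epsilon> > 0\<close> a in simp)
      also have "\<dots> = \<epsilon>\<^sup>2 / a {x, y}" using a by (simp add: power_mult_distrib power_divide)
      finally show ?thesis using a by (simp add: field_simps)
    qed
    \<comment> \<open>Completeness enters through the finiteness of this ball.\<close>
    have "{x. \<phi> x \<noteq> 0} \<subseteq> {x. ?d z x < 1 / \<epsilon>}"
      using \<open>\<epsilon> > 0\<close> by (auto simp: \<phi>_def field_simps)
    then have \<phi>: "\<phi> \<in> C0"
      unfolding C0_def using finite_weighted_ball[OF graph(1-3) pos complete]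
      by (auto intro: finite_subset)
    define f where "f x = \<phi> x * ?v x" for x
    have f: "f \<in> C0"
      using \<phi> by (auto simp: C0_def f_def)
    obtain F where F: "finite F" "\<And>x. \<phi> x \<noteq> 0 \<Longrightarrow> x \<in> F \<and> neighbours E x \<subseteq> F"
      using finite_support_neighbourhood[OF graph(2) \<phi>] by metis
    have supp: "x \<in> F" if "f x \<noteq> 0" for x
      using that F(2) by (auto simp: f_def)
    have nf: "(norm (Abs_l2 f))\<^sup>2 = (\<Sum>x\<in>F. f x * f x)"
      unfolding power2_norm_eq_inner
      using inner_Abs_C0[OF f F(1) supp] by (simp add: l2_fun_Abs_C0 f)
    have "inner (Abs_l2 (schroedinger E a W f)) (Abs_l2 f) = (\<Sum>x\<in>F. schroedinger E a W f x * f x)"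
      using inner_Abs_C0[OF f F(1) supp, of "Abs_l2 (schroedinger E a W f)"]
      by (simp add: l2_fun_Abs_C0 schroedinger_C0[OF graph(2)] f inner_commute mult.commute)
    \<comment> \<open>The lower bound \<open>k\<close> minus the shift \<open>k - 1\<close> leaves
      exactly one copy of the squared norm.\<close>
    then have "(norm (Abs_l2 f))\<^sup>2 \<le> (\<Sum>x\<in>F. (schroedinger E a W f x - (k - 1) * f x) * f x)"
      using lower[OF f] unfolding nf
      by (simp add: left_diff_distrib sum_subtractf sum_distrib_left mult.assoc)
    also have "\<dots> = 1 / 2 * (\<Sum>x\<in>F. \<Sum>y\<in>F. if y \<in> neighbours E x
        then a {x, y} * (\<phi> x - \<phi> y)\<^sup>2 * (?v x * ?v y) else 0)"
      unfolding f_def by (rule schroedinger_cutoff[OF graph(2) F eig])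
    also have "\<dots> \<le> 1 / 2 * (\<epsilon>\<^sup>2 * N * (norm v)\<^sup>2)"
      using pos by (intro mult_left_mono cutoff_energy_le F N lip)
        (auto simp: neighbours_def less_imp_le)
    finally have "(norm (Abs_l2 f))\<^sup>2 \<le> \<epsilon>\<^sup>2 * (N * (norm v)\<^sup>2 / 2)" by simp
    moreover have "(l2_fun (Abs_l2 f) z)\<^sup>2 \<le> (norm (Abs_l2 f))\<^sup>2"
      using sum_le_norm_l2[of "{z}" "Abs_l2 f"] by simp
    moreover have "l2_fun (Abs_l2 f) z = ?v z"
      by (simp add: l2_fun_Abs_C0 f) (simp add: f_def \<phi>_def)
    ultimately show ?thesis by simp
  qed
  \<comment> \<open>The left-hand side of \<open>est\<close> does not depend on \<epsilon>, so
    \<epsilon> may tend to 0.\<close>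
  have "(?v z)\<^sup>2 \<le> 0"
  proof (rule tendsto_lowerbound)
    show "((\<lambda>\<epsilon>. \<epsilon>\<^sup>2 * (N * (norm v)\<^sup>2 / 2)) \<longlongrightarrow> 0) (at_right 0)"
      by (auto intro!: tendsto_eq_intros)
    show "\<forall>\<^sub>F \<epsilon> in at_right 0. (?v z)\<^sup>2 \<le> \<epsilon>\<^sup>2 * (N * (norm v)\<^sup>2 / 2)"
      using est by (auto simp: eventually_at_right_field intro!: exI[of _ 1])
  qed simp
  then show "?v z = l2_fun 0 z" by (simp add: zero_l2.rep_eq)
qed

theorem theorem6p1:
  fixes E :: "'v set set" and a :: "'v set \<Rightarrow> real" and W :: "'v \<Rightarrow> real"
  assumes "simple_graph E"
    and "infinite (UNIV :: 'v set)"
    and "connected_graph E"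
    and "locally_finite_graph E"
    and "bounded_degree E"
    and "\<forall>e\<in>E. a e > 0"
    and "Metric_space.mcomplete UNIV (weighted_dist E a)"
    and "\<exists>k::real. \<forall>g\<in>C0.
           inner (Abs_l2 (schroedinger E a W g)) (Abs_l2 g) \<ge> k * (norm (Abs_l2 g))\<^sup>2"
  shows "essentially_self_adjoint (schroedinger_operator E a W)"
proof -
  obtain k where k: "\<And>g. g \<in> C0 \<Longrightarrow>
      inner (Abs_l2 (schroedinger E a W g)) (Abs_l2 g) \<ge> k * (norm (Abs_l2 g))\<^sup>2"
    using assms(8) by blast
  show ?thesis
  proof (rule essentially_self_adjoint_if_lower_bounded)
    show "symmetric_operator (schroedinger_operator E a W)"
      using assms(4) by (rule symmetric_schroedinger_operator)
    show "k * (norm f)\<^sup>2 \<le> inner Tf f" if "(f, Tf) \<in> schroedinger_operator E a W" for f Tf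
      using that k by (auto simp: schroedinger_operator_def)
    show "v = 0" if "(v, (k - 1) *\<^sub>R v) \<in> adjoint_operator (schroedinger_operator E a W)" for v
      using adjoint_schroedinger_operator[OF assms(4) that]
      by (intro schroedinger_eigenvector_eq_0[OF assms(1,4,3,5-7) k])
        (simp_all add: scaleR_l2.rep_eq)
  qed
qed

end
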